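(* Let $C$ be a cycle in the Loosened Collatz graph in which $g$ is applied $n$ times, and let $Y=(y_1,\dots,y_n)$ be a tuple of $C$, i.e. its entries are, in order along the cycle, the numbers of times (possibly $0$) that $f$ is applied after each application of $g$. Then, with $y_0=0$, the value $$F_L(Y)=\frac{\sum_{i=1}^{n}3^{n-i}\cdot 2^{\sum_{j=0}^{i-1}y_j}}{2^{\sum_{i=1}^{n}y_i}-3^n}$$ is a positive integer and is one of the vertices of $C$ to which $g$ is applied in $C$.
   Context: $\mathbb{N}_1$ denotes the positive integers. Let $f:n\mapsto n/2$ (applied only to even $n$) and $g:n\mapsto 3n+1$. The Loosened Collatz graph is the directed graph with vertex set $\mathbb{N}_1$ having an edge $n\to g(n)=3n+1$ for every $n\in\mathbb{N}_1$, and an edge $n\to f(n)=n/2$ for every even $n\in\mathbb{N}_1$. (Equivalently, it is generated by the inverse relation $L(n)=\{2n\}$ if $n\equiv 0,2 \pmod 3$, $L(n)=\{2n,(n-1)/3\}$ if $n\equiv 1\pmod 3$, except that $L(1)=\{2\}$.) A cycle is a simple directed circuit in this graph. We say $f$ (resp. $g$) is applied to a vertex in the cycle if the cycle leaves that vertex along its $f$-edge (resp. $g$-edge). Tuple of a cycle: given a cycle in which $g$ is applied $n$ times, pick a vertex $x_1$ of the cycle to which $g$ is applied. Let $y_1\ge 0$ be the number of applications of $f$ following $g$ at $x_1$ before $g$ is applied again, and let $x_2=f^{y_1}(g(x_1))$ be the vertex to which $g$ is next applied; continue in this way, $x_{k+1}=f^{y_k}(g(x_k))$ for $1\le k<n$,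 until $x_1=f^{y_n}(g(x_n))$. The tuple is $(y_1,\dots,y_n)$. *)

theory Defs
  imports Complex_Main "Graph_Theory.Pair_Digraph"
begin

definition f :: "nat \<Rightarrow> nat" where
  "f v = v div 2"

definition g :: "nat \<Rightarrow> nat" where
  "g v = 3 * v + 1"

text \<open>
  No pair \<open>(v, w)\<close> is both an \<open>f\<close>-edge and a \<open>g\<close>-edge, since \<open>f v < g v\<close>; so the
  two kinds of edges need no labels, and the graph has no parallel arcs.
\<close>

definition loosened_collatz :: "nat pair_pre_digraph" where
  "loosened_collatz =
    \<lparr> pverts = {v. v \<ge> 1},
      parcs = {(v, g v) | v. v \<ge> 1} \<union> {(v, f v) | v. v \<ge> 1 \<and> even v} \<rparr>"

text \<open>
  A cycle is the list of its arcs (the predicate \<open>pre_digraph.cycle\<close>): a nonempty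
  closed walk that repeats no vertex apart from returning to its start.
\<close>

abbreviation collatz_cycle :: "(nat \<times> nat) list \<Rightarrow> bool" where
  "collatz_cycle C \<equiv> pre_digraph.cycle (with_proj loosened_collatz) C"

definition g_vertices :: "(nat \<times> nat) list \<Rightarrow> nat set" where
  "g_vertices C = {v. (v, g v) \<in> set C}"

text \<open>
  On a cycle \<open>C\<close> and for \<open>x \<in> g_vertices C\<close>: the vertices after \<open>g x\<close> are left along
  their \<open>f\<close>-edge until a vertex of \<open>g_vertices C\<close> is met, so \<open>f_count C x\<close> is the
  number of applications of \<open>f\<close> between the application of \<open>g\<close> at \<open>x\<close> and the next
  application of \<open>g\<close>, which takes place at \<open>next_g C x\<close>.
\<close>

definition f_count :: "(nat \<times> nat) list \<Rightarrow> nat \<Rightarrow> nat" where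
  "f_count C x = (LEAST y. (f ^^ y) (g x) \<in> g_vertices C)"

definition next_g :: "(nat \<times> nat) list \<Rightarrow> nat \<Rightarrow> nat" where
  "next_g C x = (f ^^ f_count C x) (g x)"

text \<open>
  Since a cycle leaves each of its vertices once, \<open>card (g_vertices C)\<close> is the number
  of applications of \<open>g\<close>. Entry \<open>k\<close> of the list (counted from 0) is the number
  \<open>y\<^sub>k\<^sub>+\<^sub>1\<close> of applications of \<open>f\<close> after \<open>g\<close> at \<open>x\<^sub>k\<^sub>+\<^sub>1 = (next_g C ^^ k) x\<^sub>1\<close>.
\<close>

definition tuple_from :: "(nat \<times> nat) list \<Rightarrow> nat \<Rightarrow> nat list" where
  "tuple_from C x1 = map (\<lambda>k. f_count C ((next_g C ^^ k) x1)) [0..<card (g_vertices C)]"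

definition is_tuple_of :: "nat list \<Rightarrow> (nat \<times> nat) list \<Rightarrow> bool" where
  "is_tuple_of Y C \<longleftrightarrow> (\<exists>x1 \<in> g_vertices C. Y = tuple_from C x1)"

text \<open>Prepending \<open>0\<close> gives \<open>y\<^sub>0 = 0\<close> and the index shift to \<open>y\<^sub>1, \<dots>, y\<^sub>n\<close>.\<close>

definition F_L :: "nat list \<Rightarrow> rat" where
  "F_L Y =
    (let n = length Y; y = (\<lambda>j. (0 # Y) ! j)
     in (\<Sum>i = 1..n. 3 ^ (n - i) * 2 ^ (\<Sum>j = 0..i - 1. y j))
          / (2 ^ (\<Sum>i = 1..n. y i) - 3 ^ n))"

end

theory Submission
  imports Defs "HOL-Library.Infinite_Set" "HOL-Number_Theory.Cong"
begin

text \<open>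
  If \<open>x\<^sub>1, \<dots>, x\<^sub>n\<close> are the vertices of the cycle to which \<open>g\<close> is applied, in the order of
  the cycle, then halving \<open>y\<^sub>k\<close> times leads from \<open>3 x\<^sub>k + 1\<close> to \<open>x\<^sub>k\<^sub>+\<^sub>1\<close>, and each halving is
  exact, so \<open>2 ^ y\<^sub>k * x\<^sub>k\<^sub>+\<^sub>1 = 3 * x\<^sub>k + 1\<close>. Composing these affine relations around the cycle
  gives \<open>2 ^ (y\<^sub>1 + \<dots> + y\<^sub>n) * x\<^sub>1 = 3 ^ n * x\<^sub>1 + S\<close>, where \<open>S\<close> is the numerator of
  \<open>F_L Y\<close> (lemma \<open>affine_steps_compose\<close>). The denominator is nonzero because a positive power
  of 3 is not a power of 2, so \<open>F_L Y = x\<^sub>1\<close>: the value is the very vertex at which the tuple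
  starts.

  The remaining point is combinatorial: the first-return map \<open>next_g C\<close>, iterated as many times
  as there are applications of \<open>g\<close>, must come back to \<open>x\<^sub>1\<close>. For this the cycle is unrolled into a
  periodic sequence \<open>c\<close> of vertices with \<open>c 0 = x\<^sub>1\<close>. The positions holding a vertex to which \<open>g\<close>
  is applied form an infinite set of naturals, and \<open>next_g C\<close> moves from each of them to the next
  larger one; so the iterates of \<open>next_g C\<close> follow the increasing enumeration of this set, in
  which the position after one full period has the number of those in one period as its index
  (lemmas \<open>funpow_next_g\<close> and \<open>next_g_returns\<close>).
\<close>

section \<open>Composing the affine steps\<close>

lemma affine_steps_compose:
  fixes x y :: "nat \<Rightarrow> nat"
  assumes "\<And>k. k < n \<Longrightarrow> 2 ^ y k * x (Suc k) = 3 * x k + 1"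
  shows "2 ^ (\<Sum>k<n. y k) * x n = 3 ^ n * x 0 + (\<Sum>k<n. 3 ^ (n - Suc k) * 2 ^ (\<Sum>j<k. y j))"
  using assms
proof (induction n)
  case 0
  then show ?case by simp
next
  case (Suc n)
  let ?S = "\<lambda>m. \<Sum>k<m. 3 ^ (m - Suc k) * 2 ^ (\<Sum>j<k. y j) :: nat"
  have "?S (Suc n) = 3 * ?S n + 2 ^ (\<Sum>j<n. y j)"
    by (simp add: sum_distrib_left mult.assoc[symmetric] power_Suc[symmetric] Suc_diff_Suc
        del: power_Suc)
  moreover have "2 ^ (\<Sum>k<Suc n. y k) * x (Suc n) = 2 ^ (\<Sum>k<n. y k) * (3 * x n + 1)"
    by (simp add: power_add Suc.prems mult.assoc)
  moreover have "2 ^ (\<Sum>k<n. y k) * x n = 3 ^ n * x 0 + ?S n"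
    using Suc by simp
  ultimately show ?case
    by (simp add: algebra_simps)
qed

text \<open>Counting entries from 0 brings \<open>F_L\<close> into the form of \<open>affine_steps_compose\<close>.\<close>

lemma F_L_eq:
  "F_L Y = (\<Sum>k<length Y. 3 ^ (length Y - Suc k) * 2 ^ (\<Sum>j<k. Y ! j))
             / (2 ^ (\<Sum>k<length Y. Y ! k) - 3 ^ length Y)"
proof -
  have reindex: "(\<Sum>i = 1..n. h i) = (\<Sum>k<n. h (Suc k))" for h :: "nat \<Rightarrow> 'b::comm_monoid_add" and n
    by (simp add: sum.atLeast1_atMost_eq)
  have "(\<Sum>j = 0..k. (0 # Y) ! j) = (\<Sum>j<k. Y ! j)" for k
    by (simp add: sum.atLeast_Suc_atMost reindex[unfolded One_nat_def])
  then show ?thesis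
    by (simp add: F_L_def Let_def reindex[unfolded One_nat_def])
qed

lemma power_two_neq_power_three:
  assumes "n > 0"
  shows "(2::rat) ^ s \<noteq> 3 ^ n"
proof
  assume "(2::rat) ^ s = 3 ^ n"
  then have eq: "(2::nat) ^ s = 3 ^ n"
    by (metis of_nat_eq_iff of_nat_numeral of_nat_power)
  have "odd ((3::nat) ^ n)" by simp
  with eq have "s = 0" by (metis even_power even_numeral gr0I)
  with eq one_less_power[of "3::nat" n] assms show False by simp
qed

lemma F_L_of_closed_steps:
  fixes x :: "nat \<Rightarrow> nat"
  assumes "Y \<noteq> []"
    and "\<And>k. k < length Y \<Longrightarrow> 2 ^ (Y ! k) * x (Suc k) = 3 * x k + 1"
    and "x (length Y) = x 0"
  shows "F_L Y = of_nat (x 0)"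
proof -
  let ?n = "length Y" and ?s = "\<Sum>k<length Y. Y ! k"
  have "(2::nat) ^ ?s * x 0
      = 3 ^ ?n * x 0 + (\<Sum>k<?n. 3 ^ (?n - Suc k) * 2 ^ (\<Sum>j<k. Y ! j))"
    using affine_steps_compose[of ?n "\<lambda>k. Y ! k" x] assms(2,3) by simp
  from arg_cong[OF this, of "of_nat :: nat \<Rightarrow> rat"]
  have "(\<Sum>k<?n. 3 ^ (?n - Suc k) * 2 ^ (\<Sum>j<k. Y ! j))
      = (of_nat (x 0) :: rat) * (2 ^ ?s - 3 ^ ?n)"
    by (simp add: algebra_simps)
  moreover have "(2::rat) ^ ?s - 3 ^ ?n \<noteq> 0"
    using power_two_neq_power_three[of ?n ?s] assms(1) by simp
  ultimately show ?thesis
    by (simp add: F_L_eq)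
qed

section \<open>Unrolling a cycle into a periodic sequence\<close>

text \<open>
  The sequence \<open>c\<close> runs around the cycle \<open>C\<close> of length \<open>L\<close> forever. The start \<open>c 0\<close> is free, so
  that it can be put at any vertex of the cycle.
\<close>

locale unrolled_cycle =
  fixes C :: "(nat \<times> nat) list" and c :: "nat \<Rightarrow> nat" and L :: nat
  assumes length_pos: "L > 0"
    and periodic: "c (i + L) = c i"
    and inj: "inj_on c {..<L}"
    and arcs_eq: "set C = (\<lambda>i. (c i, c (Suc i))) ` {..<L}"
    and collatz_arcs: "(v, w) \<in> set C \<Longrightarrow> v > 0 \<and> (w = g v \<or> even v \<and> w = f v)"

lemma pawalk_verts_eq_tails:
  "pcas u p v \<Longrightarrow> pawalk_verts u p = map fst p @ [v]"
  by (induction p arbitrary: u) auto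

lemma walk_tails_heads_shift:
  "pcas u p v \<Longrightarrow> map fst p @ [v] = u # map snd p"
  by (induction p arbitrary: u) auto

lemma cycle_unrolls:
  assumes "collatz_cycle C" and "x \<in> fst ` set C"
  obtains c where "unrolled_cycle C c (length C)" and "c 0 = x"
proof -
  define L where "L = length C"
  obtain u where walk: "set C \<subseteq> parcs loosened_collatz" "pcas u C u" and "C \<noteq> []"
    and dist: "distinct (tl (pawalk_verts u C))"
    using assms(1)
    by (auto simp: pre_digraph.cycle_def pre_digraph.awalk_def cas_with_proj_eq
        awalk_verts_with_proj_eq)
  have shift: "map fst C @ [u] = u # map snd C"
    using walk(2) by (rule walk_tails_heads_shift)
  have verts: "pawalk_verts u C = map fst C @ [u]"
    using walk(2) by (rule pawalk_verts_eq_tails)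
  have L: "L > 0" using \<open>C \<noteq> []\<close> by (simp add: L_def)
  have "distinct (map snd C)"
    using dist verts shift by simp
  \<comment> \<open>A list is distinct iff its set has as many elements as its length, so distinctness
    passes from the heads to the tails once both lists have the same set.\<close>
  moreover have "set (map fst C) = set (map snd C)"
  proof -
    have "mset (map fst C) + {#u#} = mset (map snd C) + {#u#}"
      using arg_cong[OF shift, of mset] by simp
    then have "mset (map fst C) = mset (map snd C)"
      by (simp only: add_right_cancel)
    then show ?thesis by (rule mset_eq_setD)
  qed
  ultimately have dist_fst: "distinct (map fst C)"
    by (metis card_distinct distinct_card length_map)
  have next_tail: "snd (C ! i) = fst (C ! (Suc i mod L))" if "i < L" for i
  proof (cases "Suc i < L")
    case True
    then show ?thesis
      using arg_cong[OF shift, of "\<lambda>xs. xs ! Suc i"] by (simp add: nth_append L_def)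
  next
    case False
    with that have "Suc i = L" "i = L - 1" by simp_all
    then show ?thesis
      using arg_cong[OF shift, of "\<lambda>xs. xs ! Suc i"] arg_cong[OF shift, of hd] L
      by (simp add: nth_append L_def hd_append hd_map hd_conv_nth split: if_splits)
  qed
  \<comment> \<open>\<open>p\<close> is the rotation that makes the sequence start at \<open>x\<close>.\<close>
  obtain p where p: "p < L" "fst (C ! p) = x"
    using assms(2) by (auto simp: in_set_conv_nth L_def)
  define c where "c i = fst (C ! ((i + p) mod L))" for i
  have arc: "(c i, c (Suc i)) = C ! ((i + p) mod L)" for i
    using next_tail[of "(i + p) mod L"] L by (simp add: c_def mod_Suc_eq prod_eq_iff)
  have inj_shift: "inj_on (\<lambda>i. (i + p) mod L) {..<L}"
  proof (rule inj_onI)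
    fix i j assume "i \<in> {..<L}" "j \<in> {..<L}" "(i + p) mod L = (j + p) mod L"
    then show "i = j"
      by (metis cong_def cong_add_rcancel_nat lessThan_iff mod_less)
  qed
  then have img: "(\<lambda>i. (i + p) mod L) ` {..<L} = {..<L}"
    using L by (intro endo_inj_surj) auto
  have "unrolled_cycle C c L"
  proof
    show "L > 0" by (fact L)
    show "c (i + L) = c i" for i
      by (simp add: c_def add.commute add.left_commute)
    show "inj_on c {..<L}"
    proof (rule inj_onI)
      fix i j assume ij: "i \<in> {..<L}" "j \<in> {..<L}" "c i = c j"
      have "map fst C ! ((i + p) mod L) = map fst C ! ((j + p) mod L)"
        using ij(3) L by (simp add: c_def L_def)
      then have "(i + p) mod L = (j + p) mod L"
        using dist_fst L by (subst (asm) nth_eq_iff_index_eq) (auto simp: L_def)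
      with inj_shift ij show "i = j" by (auto dest: inj_onD)
    qed
    have "(\<lambda>i. (c i, c (Suc i))) ` {..<L} = (!) C ` (\<lambda>i. (i + p) mod L) ` {..<L}"
      by (simp add: arc image_image)
    then show "set C = (\<lambda>i. (c i, c (Suc i))) ` {..<L}"
      unfolding img by (auto simp: set_conv_nth L_def)
    show "v > 0 \<and> (w = g v \<or> even v \<and> w = f v)" if "(v, w) \<in> set C" for v w
      using walk(1) that by (auto simp: loosened_collatz_def)
  qed
  moreover have "c 0 = x" using p by (simp add: c_def)
  ultimately show ?thesis using that by (simp add: L_def)
qed

section \<open>The first-return map to the vertices with an application of \<open>g\<close>\<close>

context unrolled_cycle
begin

definition g_positions :: "nat set" where
  "g_positions = {i. c i \<in> g_vertices C}"

lemma c_mod: "c (i mod L) = c i"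
proof -
  have "c (j + L * k) = c j" for j k
    by (induction k) (simp_all add: periodic add.assoc[symmetric] add.commute[of L])
  from this[of "i mod L" "i div L"] show ?thesis by simp
qed

lemma arc_at: "(c i, c (Suc i)) \<in> set C"
proof -
  have "(c (i mod L), c (Suc (i mod L))) \<in> set C"
    using length_pos by (auto simp: arcs_eq)
  then show ?thesis
    by (metis c_mod mod_Suc_eq)
qed

text \<open>No vertex occurs twice within a period, so the cycle leaves each vertex along one arc only.
  Hence a vertex in \<open>g_vertices C\<close> is always left along its \<open>g\<close>-edge.\<close>

lemma arc_from_unique:
  assumes "(c i, w) \<in> set C"
  shows "w = c (Suc i)"
proof -
  obtain k where k: "k < L" "c i = c k" "w = c (Suc k)"
    using assms by (auto simp: arcs_eq)
  then have "k = i mod L"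
    using inj length_pos c_mod[of i] by (auto dest: inj_onD)
  then show ?thesis
    using k(3) by (metis c_mod mod_Suc_eq)
qed

lemma step_at_g: "i \<in> g_positions \<Longrightarrow> c (Suc i) = g (c i)"
  using arc_from_unique by (auto simp: g_positions_def g_vertices_def)

lemma step_at_f: "i \<notin> g_positions \<Longrightarrow> even (c i) \<and> c (Suc i) = f (c i)"
  using collatz_arcs[OF arc_at[of i]] arc_at[of i]
  by (auto simp: g_positions_def g_vertices_def)

text \<open>Between two consecutive applications of \<open>g\<close> the cycle only halves even numbers. So the
  powers of \<open>f\<close> in \<open>f_count\<close> follow the cycle and first meet \<open>g_vertices C\<close> at position \<open>j\<close>,
  and undoing the halvings loses no remainder.\<close>

lemma first_return:
  assumes "i \<in> g_positions" "j \<in> g_positions" "i < j"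
    and gap: "\<And>k. i < k \<Longrightarrow> k < j \<Longrightarrow> k \<notin> g_positions"
  shows "next_g C (c i) = c j" and "2 ^ f_count C (c i) * c j = 3 * c i + 1"
proof -
  define d where "d = j - Suc i"
  have j: "j = Suc i + d" using assms(3) by (simp add: d_def)
  have descent: "(f ^^ y) (g (c i)) = c (Suc i + y) \<and> 2 ^ y * c (Suc i + y) = g (c i)"
    if "y \<le> d" for y
    using that
  proof (induction y)
    case 0
    then show ?case using step_at_g[OF assms(1)] by simp
  next
    case (Suc y)
    then have "even (c (Suc i + y))" "c (Suc (Suc i + y)) = f (c (Suc i + y))"
      using step_at_f[of "Suc i + y"] gap[of "Suc i + y"] by (simp_all add: j)
    with Suc show ?case by (auto simp: f_def)
  qed
  have "f_count C (c i) = d"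
    unfolding f_count_def
  proof (rule Least_equality)
    show "(f ^^ d) (g (c i)) \<in> g_vertices C"
      using descent[of d] assms(2) by (simp add: j g_positions_def)
    show "d \<le> y" if "(f ^^ y) (g (c i)) \<in> g_vertices C" for y
    proof (rule ccontr)
      assume "\<not> d \<le> y"
      then have "Suc i + y \<in> g_positions"
        using descent[of y] that by (simp add: g_positions_def)
      then show False
        using gap[of "Suc i + y"] \<open>\<not> d \<le> y\<close> by (simp add: j)
    qed
  qed
  then show "next_g C (c i) = c j" "2 ^ f_count C (c i) * c j = 3 * c i + 1"
    using descent[of d] by (simp_all add: j next_g_def g_def)
qed

lemma first_return_enumerate:
  assumes "infinite g_positions"
  shows "next_g C (c (enumerate g_positions k)) = c (enumerate g_positions (Suc k))"
    and "2 ^ f_count C (c (enumerate g_positions k)) * c (enumerate g_positions (Suc k))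
           = 3 * c (enumerate g_positions k) + 1"
proof -
  let ?e = "enumerate g_positions"
  have "m \<notin> g_positions" if "?e k < m" "m < ?e (Suc k)" for m
    using that not_less_Least[of m "\<lambda>s. s \<in> g_positions \<and> ?e k < s"] enumerate_Suc''[OF assms, of k]
    by auto
  with enumerate_in_set[OF assms] enumerate_step[OF assms, of k]
  show "next_g C (c (?e k)) = c (?e (Suc k))"
    and "2 ^ f_count C (c (?e k)) * c (?e (Suc k)) = 3 * c (?e k) + 1"
    using first_return[of "?e k" "?e (Suc k)"] by blast+
qed

lemma infinite_g_positions:
  assumes "i \<in> g_positions"
  shows "infinite g_positions"
proof -
  have "i + k * L \<in> g_positions" for k
    using assms c_mod[of "i + k * L"] c_mod[of i] by (simp add: g_positions_def)
  moreover have "inj (\<lambda>k. i + k * L)"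
    using length_pos by (auto simp: inj_on_def)
  ultimately show ?thesis
    by (metis finite_subset image_subsetI infinite_UNIV_nat finite_image_iff)
qed

context
  assumes start: "0 \<in> g_positions"
begin

lemma enumerate_0_start: "enumerate g_positions 0 = 0"
  using start by (simp add: enumerate_0)

lemma funpow_next_g: "(next_g C ^^ k) (c 0) = c (enumerate g_positions k)"
  by (induction k)
    (simp_all add: enumerate_0_start first_return_enumerate(1)[OF infinite_g_positions[OF start]])

text \<open>
  Position \<open>L\<close> holds the start vertex again. The index of the position \<open>L\<close> in the enumeration counts the smaller positions, and these
  correspond to the vertices to which \<open>g\<close> is applied, each of which occurs once in a period.
\<close>

lemma next_g_returns: "(next_g C ^^ card (g_vertices C)) (c 0) = c 0"
proof -
  let ?e = "enumerate g_positions"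
  note inf = infinite_g_positions[OF start]
  have "L \<in> g_positions"
    using start periodic[of 0] by (simp add: g_positions_def)
  then obtain m where m: "?e m = L"
    using enumerate_Ex[OF inf] by blast
  have below: "g_positions \<inter> {..<L} = ?e ` {..<m}"
  proof (intro set_eqI iffI)
    fix i assume i: "i \<in> g_positions \<inter> {..<L}"
    then obtain k where "?e k = i" using enumerate_Ex[OF inf] by blast
    with i m show "i \<in> ?e ` {..<m}"
      using enumerate_mono_iff[OF inf, of k m] by auto
  next
    fix i assume "i \<in> ?e ` {..<m}"
    with m show "i \<in> g_positions \<inter> {..<L}"
      using enumerate_in_set[OF inf] enumerate_mono_iff[OF inf] by auto
  qed
  have "g_vertices C = c ` (g_positions \<inter> {..<L})"
  proof
    show "g_vertices C \<subseteq> c ` (g_positions \<inter> {..<L})"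
      by (auto simp: g_vertices_def g_positions_def arcs_eq)
  qed (auto simp: g_positions_def)
  then have "card (g_vertices C) = card (g_positions \<inter> {..<L})"
    using inj by (metis card_image inf_le2 inj_on_subset)
  also have "\<dots> = m"
    unfolding below using strict_mono_enumerate[OF inf]
    by (simp add: card_image strict_mono_imp_inj_on inj_on_subset)
  finally show ?thesis
    using m periodic[of 0] by (simp add: funpow_next_g)
qed

end

end

section \<open>The value of \<open>F_L\<close> on a tuple of a cycle\<close>

theorem theorem1:
  fixes C :: "(nat \<times> nat) list" and Y :: "nat list"
  assumes "collatz_cycle C"
    and "is_tuple_of Y C"
  shows "\<exists>v::nat. v > 0 \<and> F_L Y = of_nat v \<and> v \<in> g_vertices C"
proof -
  obtain x where x: "x \<in> g_vertices C" and Y: "Y = tuple_from C x"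
    using assms(2) by (auto simp: is_tuple_of_def)
  have "x \<in> fst ` set C"
    using x by (force simp: g_vertices_def)
  then obtain c where "unrolled_cycle C c (length C)" and c0: "c 0 = x"
    using cycle_unrolls[OF assms(1)] by blast
  then interpret unrolled_cycle C c "length C" by simp
  have start: "0 \<in> g_positions"
    using x c0 by (simp add: g_positions_def)
  have "finite (g_vertices C)"
    by (rule finite_subset[of _ "fst ` set C"]) (force simp: g_vertices_def)+
  then have "Y \<noteq> []"
    using x by (auto simp: Y tuple_from_def)
  moreover have "2 ^ (Y ! k) * (next_g C ^^ Suc k) x = 3 * (next_g C ^^ k) x + 1"
    if "k < length Y" for k
    using that first_return_enumerate(2)[OF infinite_g_positions[OF start], of k]
      funpow_next_g[OF start, of k] funpow_next_g[OF start, of "Suc k"]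
    by (simp add: Y tuple_from_def c0)
  moreover have "(next_g C ^^ length Y) x = (next_g C ^^ 0) x"
    using next_g_returns[OF start] by (simp add: Y tuple_from_def c0)
  ultimately have "F_L Y = of_nat x"
    using F_L_of_closed_steps[of Y "\<lambda>k. (next_g C ^^ k) x"] by simp
  moreover have "x > 0"
    using x collatz_arcs by (auto simp: g_vertices_def)
  ultimately show ?thesis
    using x by blast
qed

end
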